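(* Let $X$ be a semi-rectifiable compact plane set and let $\mathcal{F}$ be an effective collection of paths in $X$. Let $f,g\in D_{\mathcal{F}}^{(1)}(X)$ be such that $g(X)\subseteq X$. Suppose that $D^{(1)}(X)$ is dense in $D_{\mathcal{F}}^{(1)}(X)$ (with respect to the norm $\|h\|_{\mathcal{F},1}=|h|_X+|h^{[1]}|_X$). Then $f\circ g\in D_{\mathcal{F}}^{(1)}(X)$ and $(f^{[1]}\circ g)\,g^{[1]}$ is the $\mathcal{F}$-derivative of $f\circ g$.
   Context: A compact plane set is a non-empty compact subset of $\mathbb{C}$. $C(X)$ is the algebra of continuous complex-valued functions on $X$, and $|f|_X=\sup_{x\in X}|f(x)|$. Paths: A path is a continuous map $\gamma:[a,b]\to\mathbb{C}$ with $a<b$ real; $\gamma^-=\gamma(a)$, $\gamma^+=\gamma(b)$, and $\gamma^*=\gamma([a,b])$; $\gamma$ is a path in $X$ if $\gamma^*\subseteq X$. A subpath of $\gamma$ is a restriction of $\gamma$ to a non-degenerate closed subinterval of $[a,b]$. $\gamma$ is rectifiable if its total variation is finite, a Jordan path if it is injective, and admissible if it is rectifiable and has no constant subpaths. Integrals $\int_\gamma f(z)\,dz$ along rectifiable paths are Riemann–Stieltjes integrals. A compact plane set $X$ is semi-rectifiable if the union of the images of all rectifiable Jordan paths in $X$ is dense in $X$ (such an $X$ has no isolated points). A collection $\mathcal{F}$ of paths in $X$ is effective if $\bigcup_{\gamma\in\mathcal{F}}\gamma^*$ is dense in $X$, each path in $\mathcal{F}$ is admissible, and every subpath of a path in $\mathcal{F}$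 belongs to $\mathcal{F}$. $\mathcal{F}$-derivatives: For $f\in C(X)$, a function $g\in C(X)$ is an $\mathcal{F}$-derivative of $f$ if $\int_\gamma g(z)\,dz=f(\gamma^+)-f(\gamma^-)$ for each $\gamma\in\mathcal{F}$; $f$ is $\mathcal{F}$-differentiable if it has an $\mathcal{F}$-derivative. When $X$ is semi-rectifiable and $\mathcal{F}$ is effective, the $\mathcal{F}$-derivative is unique and is denoted $f^{[1]}$; $D_{\mathcal{F}}^{(1)}(X)$ is the set of all $\mathcal{F}$-differentiable functions in $C(X)$, with norm $\|f\|_{\mathcal{F},1}=|f|_X+|f^{[1]}|_X$. $D^{(1)}(X)$ is the set of continuously complex-differentiable functions on $X$: those $f:X\to\mathbb{C}$ for which $f'(z)=\lim_{w\to z,\,w\in X}\frac{f(w)-f(z)}{w-z}$ exists for every $z\in X$ and $f'$ is continuous on $X$. One has $D^{(1)}(X)\subseteq D_{\mathcal{F}}^{(1)}(X)$, with $f^{[1]}=f'$ for $f\in D^{(1)}(X)$. *)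

theory Defs
  imports "HOL-Analysis.Analysis"
begin

definition compact_plane_set :: "complex set \<Rightarrow> bool" where
  "compact_plane_set X \<longleftrightarrow> compact X \<and> X \<noteq> {}"

definition sup_norm :: "complex set \<Rightarrow> (complex \<Rightarrow> complex) \<Rightarrow> real" where
  "sup_norm X f = (SUP x\<in>X. norm (f x))"


section \<open>Paths\<close>

text \<open>
  A path carries its own parameter interval. The values of its map outside that interval are
  normalised by \<^const>\<open>extensional\<close>, so that two paths are equal iff they are equal as
  functions on their intervals.
\<close>

datatype plane_path = Plane_Path (lo: real) (hi: real) (fn: "real \<Rightarrow> complex")

definition is_path :: "plane_path \<Rightarrow> bool" where
  "is_path \<gamma> \<longleftrightarrow> lo \<gamma> < hi \<gamma> \<and> continuous_on {lo \<gamma>..hi \<gamma>} (fn \<gamma>)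
     \<and> fn \<gamma> \<in> extensional {lo \<gamma>..hi \<gamma>}"

definition path_start :: "plane_path \<Rightarrow> complex" where
  "path_start \<gamma> = fn \<gamma> (lo \<gamma>)"

definition path_end :: "plane_path \<Rightarrow> complex" where
  "path_end \<gamma> = fn \<gamma> (hi \<gamma>)"

definition path_im :: "plane_path \<Rightarrow> complex set" where
  "path_im \<gamma> = fn \<gamma> ` {lo \<gamma>..hi \<gamma>}"

definition path_in :: "complex set \<Rightarrow> plane_path \<Rightarrow> bool" where
  "path_in X \<gamma> \<longleftrightarrow> is_path \<gamma> \<and> path_im \<gamma> \<subseteq> X"

definition subpath_of :: "plane_path \<Rightarrow> plane_path \<Rightarrow> bool" where
  "subpath_of \<sigma> \<gamma> \<longleftrightarrow>
     (\<exists>c d. lo \<gamma> \<le> c \<and> c < d \<and> d \<le> hi \<gamma> \<and> \<sigma> = Plane_Path c d (restrict (fn \<gamma>) {c..d}))"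

definition constant_path :: "plane_path \<Rightarrow> bool" where
  "constant_path \<gamma> \<longleftrightarrow> (\<exists>w. \<forall>t\<in>{lo \<gamma>..hi \<gamma>}. fn \<gamma> t = w)"

definition rectifiable :: "plane_path \<Rightarrow> bool" where
  "rectifiable \<gamma> \<longleftrightarrow>
     (\<exists>B. \<forall>\<D>. \<D> division_of {lo \<gamma>..hi \<gamma>} \<longrightarrow>
        (\<Sum>K\<in>\<D>. norm (fn \<gamma> (Sup K) - fn \<gamma> (Inf K))) \<le> B)"

definition jordan_path :: "plane_path \<Rightarrow> bool" where
  "jordan_path \<gamma> \<longleftrightarrow> inj_on (fn \<gamma>) {lo \<gamma>..hi \<gamma>}"

definition admissible :: "plane_path \<Rightarrow> bool" where
  "admissible \<gamma> \<longleftrightarrow> rectifiable \<gamma> \<and> (\<forall>\<sigma>. subpath_of \<sigma> \<gamma> \<longrightarrow> \<not> constant_path \<sigma>)"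

text \<open>
  Riemann--Stieltjes integral of \<open>f\<close> along \<open>\<gamma>\<close>, as the limit of tagged sums when the mesh tends
  to 0.
\<close>

definition has_path_integral ::
    "(complex \<Rightarrow> complex) \<Rightarrow> complex \<Rightarrow> plane_path \<Rightarrow> bool" where
  "has_path_integral f I \<gamma> \<longleftrightarrow>
     (\<forall>\<epsilon>>0. \<exists>\<delta>>0. \<forall>\<D>. \<D> tagged_division_of {lo \<gamma>..hi \<gamma>} \<longrightarrow>
        (\<forall>(t, K)\<in>\<D>. Sup K - Inf K < \<delta>) \<longrightarrow>
        norm ((\<Sum>(t, K)\<in>\<D>. f (fn \<gamma> t) * (fn \<gamma> (Sup K) - fn \<gamma> (Inf K))) - I) < \<epsilon>)"


section \<open>Semi-rectifiable sets and effective collections\<close>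

definition semi_rectifiable :: "complex set \<Rightarrow> bool" where
  "semi_rectifiable X \<longleftrightarrow>
     X \<subseteq> closure (\<Union>{path_im \<gamma> | \<gamma>. path_in X \<gamma> \<and> rectifiable \<gamma> \<and> jordan_path \<gamma>})"

definition effective :: "complex set \<Rightarrow> plane_path set \<Rightarrow> bool" where
  "effective X F \<longleftrightarrow>
     (\<forall>\<gamma>\<in>F. path_in X \<gamma>) \<and>
     X \<subseteq> closure (\<Union>\<gamma>\<in>F. path_im \<gamma>) \<and>
     (\<forall>\<gamma>\<in>F. admissible \<gamma>) \<and>
     (\<forall>\<gamma>\<in>F. \<forall>\<sigma>. subpath_of \<sigma> \<gamma> \<longrightarrow> \<sigma> \<in> F)"


section \<open>Derivatives\<close>

text \<open>
  Elements of \<open>C(X)\<close> are represented by total functions that are continuous on \<open>X\<close>; their values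
  off \<open>X\<close> are irrelevant. The derivative \<open>F_deriv X F f\<close> is normalised to be extensional on \<open>X\<close>,
  since it is only determined there.
\<close>

definition is_F_derivative ::
    "complex set \<Rightarrow> plane_path set \<Rightarrow> (complex \<Rightarrow> complex) \<Rightarrow> (complex \<Rightarrow> complex) \<Rightarrow> bool" where
  "is_F_derivative X F f g \<longleftrightarrow>
     continuous_on X f \<and> continuous_on X g \<and>
     (\<forall>\<gamma>\<in>F. has_path_integral g (f (path_end \<gamma>) - f (path_start \<gamma>)) \<gamma>)"

definition DF1 :: "complex set \<Rightarrow> plane_path set \<Rightarrow> (complex \<Rightarrow> complex) set" where
  "DF1 X F = {f. \<exists>g. is_F_derivative X F f g}"

definition F_deriv ::
    "complex set \<Rightarrow> plane_path set \<Rightarrow> (complex \<Rightarrow> complex) \<Rightarrow> complex \<Rightarrow> complex" where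
  "F_deriv X F f = (THE g. g \<in> extensional X \<and> is_F_derivative X F f g)"

definition F_norm :: "complex set \<Rightarrow> plane_path set \<Rightarrow> (complex \<Rightarrow> complex) \<Rightarrow> real" where
  "F_norm X F f = sup_norm X f + sup_norm X (F_deriv X F f)"

definition D1 :: "complex set \<Rightarrow> (complex \<Rightarrow> complex) set" where
  "D1 X = {f. \<exists>f'. (\<forall>z\<in>X. (f has_field_derivative f' z) (at z within X)) \<and> continuous_on X f'}"

definition D1_dense :: "complex set \<Rightarrow> plane_path set \<Rightarrow> bool" where
  "D1_dense X F \<longleftrightarrow>
     (\<forall>h\<in>DF1 X F. \<forall>\<epsilon>>0. \<exists>k\<in>D1 X. F_norm X F (\<lambda>z. h z - k z) < \<epsilon>)"

end

theory Submission
  imports Defs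
begin

text \<open>
  The chain rule holds for outer functions in \<open>D\<^sup>(\<^sup>1\<^sup>)(X)\<close>, and it survives limits of the outer
  function in the norm \<open>|h| + |h\<^sup>[\<^sup>1\<^sup>]|\<close>; so density gives it for all outer functions.

  Path integrals are handled through one kind of inequality. Let \<open>W\<close> be a real function whose
  increments dominate those of the path \<open>p\<close>; a rectifiable path has one, its variation function
  (\<open>rectifiable_dominated\<close>). Then, for continuous \<open>f\<close> and \<open>h\<close> on \<open>X\<close>,
  \<open>h\<close> is an \<open>F\<close>-derivative of \<open>f\<close> iff along every path of
  \<open>F\<close> and on every parameter interval \<open>[u,v]\<close> the mean value estimate
  \<open>|f(p(v)) - f(p(u)) - c (p(v) - p(u))| \<le> \<eta> (W(v) - W(u))\<close>
  holds whenever \<open>|h(p(t)) - c|\<close> is at most \<open>\<eta>\<close> on \<open>[u,v]\<close>. One direction bounds the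
  Riemann--Stieltjes sums of a subpath, the other one uses that the integrand is uniformly
  continuous (\<open>F_derivative_mean_value_primitive\<close>, \<open>is_F_derivativeI\<close>). By Cousin's lemma it is
  enough to know such an estimate to first order at each point
  (\<open>mean_value_primitive_localI\<close>), with \<open>W(v) - W(u)\<close> as the unit of length.

  This makes the chain rule for \<open>f\<close> with a genuine complex derivative \<open>f'\<close> on \<open>X\<close> a pointwise
  computation (\<open>F_derivative_chain_rule_D1\<close>): if \<open>h\<close> is an \<open>F\<close>-derivative of \<open>g\<close>, then \<open>g\<close>
  moves along the path at speed at most \<open>sup |h|\<close> relative to \<open>W\<close>, so an error that is small
  compared with the increment of \<open>g\<close> is small compared with the increment of \<open>W\<close>.

  The estimates survive uniform limits of \<open>f\<close> and \<open>h\<close> (\<open>is_F_derivative_uniform_limit\<close>). If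
  \<open>k \<in> D\<^sup>(\<^sup>1\<^sup>)(X)\<close> is close to \<open>f\<close> in norm, then \<open>k \<circ> g\<close> is uniformly close to \<open>f \<circ> g\<close> because
  \<open>g\<close> maps \<open>X\<close> into \<open>X\<close>, and \<open>(k' \<circ> g) g\<^sup>[\<^sup>1\<^sup>]\<close> is uniformly close to \<open>(f\<^sup>[\<^sup>1\<^sup>] \<circ> g) g\<^sup>[\<^sup>1\<^sup>]\<close> because
  \<open>g\<^sup>[\<^sup>1\<^sup>]\<close> is bounded. To read the norm in this way the \<open>F\<close>-derivative has to be unique
  (\<open>F_derivative_zero\<close>); this is where the absence of constant subpaths and the density of the
  path images enter.
\<close>

section \<open>Variation of a rectifiable path\<close>

definition dominates :: "(real \<Rightarrow> real) \<Rightarrow> (real \<Rightarrow> complex) \<Rightarrow> real set \<Rightarrow> bool" where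
  "dominates W p S \<longleftrightarrow> (\<forall>u\<in>S. \<forall>v\<in>S. u \<le> v \<longrightarrow> norm (p v - p u) \<le> W v - W u)"

lemma dominatesD:
  "dominates W p {a..b} \<Longrightarrow> a \<le> u \<Longrightarrow> u \<le> v \<Longrightarrow> v \<le> b \<Longrightarrow> norm (p v - p u) \<le> W v - W u"
  by (auto simp: dominates_def)

lemma dominates_incr:
  "dominates W p {a..b} \<Longrightarrow> a \<le> u \<Longrightarrow> u \<le> v \<Longrightarrow> v \<le> b \<Longrightarrow> 0 \<le> W v - W u"
  using dominatesD[of W p a b u v] norm_ge_zero[of "p v - p u"] by linarith

lemma division_insert_interval:
  fixes a u v :: real
  assumes D: "D division_of {a..u}" and "a \<le> u" "u < v"
  shows "insert {u..v} D division_of {a..v}" and "{u..v} \<notin> D"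
proof -
  show notin: "{u..v} \<notin> D"
  proof
    assume "{u..v} \<in> D"
    then have "{u..v} \<subseteq> {a..u}" using D by blast
    then show False using assms by auto
  qed
  have "{cbox u v} division_of cbox u v" using assms by (intro division_of_self) auto
  then have 1: "{{u..v}} division_of {u..v}" by simp
  have "D \<union> {{u..v}} division_of {a..u} \<union> {u..v}"
    by (rule division_disjoint_union[OF D 1]) auto
  moreover have "{a..u} \<union> {u..v} = {a..v}" using assms by auto
  ultimately show "insert {u..v} D division_of {a..v}" by simp
qed

text \<open>
  The variation of \<open>\<gamma>\<close> up to time \<open>u\<close> serves as \<open>W\<close>. Appending \<open>[u,v]\<close> to a division of
  \<open>[lo \<gamma>,u]\<close> makes it superadditive, which is all that domination asks for.
\<close>
lemma rectifiable_dominated: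
  assumes "rectifiable \<gamma>"
  obtains W where "dominates W (fn \<gamma>) {lo \<gamma>..hi \<gamma>}"
proof -
  define S where "S D = (\<Sum>K\<in>D. norm (fn \<gamma> (Sup K) - fn \<gamma> (Inf K)))" for D
  define T where "T u = {S D | D. D division_of {lo \<gamma>..u}}" for u
  obtain B where B: "S D \<le> B" if "D division_of {lo \<gamma>..hi \<gamma>}" for D
    using assms unfolding rectifiable_def S_def by blast
  have step: "S (insert {u..v} D) = norm (fn \<gamma> v - fn \<gamma> u) + S D"
    if "D division_of {lo \<gamma>..u}" "lo \<gamma> \<le> u" "u < v" for D u v
    using division_insert_interval[OF that] that division_of_finite[OF that(1)] by (simp add: S_def)
  have bdd: "s \<le> B" if u: "lo \<gamma> \<le> u" "u \<le> hi \<gamma>" and s: "s \<in> T u" for u s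
  proof -
    obtain D where D: "D division_of {lo \<gamma>..u}" "s = S D" using s unfolding T_def by blast
    show ?thesis
    proof (cases "u = hi \<gamma>")
      case True
      then show ?thesis using B D by auto
    next
      case False
      then have lt: "u < hi \<gamma>" using u by simp
      have "S D \<le> S (insert {u..hi \<gamma>} D)" using step[OF D(1) u(1) lt] by simp
      also have "\<dots> \<le> B" using division_insert_interval(1)[OF D(1) u(1) lt] by (rule B)
      finally show ?thesis using D by simp
    qed
  qed
  have "norm (fn \<gamma> v - fn \<gamma> u) \<le> Sup (T v) - Sup (T u)"
    if uv: "lo \<gamma> \<le> u" "u \<le> v" "v \<le> hi \<gamma>" for u v
  proof (cases "u = v")
    case False
    then have lt: "u < v" using uv by simp
    have "{cbox (lo \<gamma>) u} division_of cbox (lo \<gamma>) u" using uv by (intro division_of_self) auto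
    then have ne: "T u \<noteq> {}" unfolding T_def by auto
    have "s \<le> Sup (T v) - norm (fn \<gamma> v - fn \<gamma> u)" if s: "s \<in> T u" for s
    proof -
      obtain D where D: "D division_of {lo \<gamma>..u}" "s = S D" using s unfolding T_def by blast
      have "S (insert {u..v} D) \<in> T v"
        using division_insert_interval(1)[OF D(1) uv(1) lt] unfolding T_def by blast
      then have "S (insert {u..v} D) \<le> Sup (T v)"
        by (rule cSup_upper) (use bdd[of v] uv in \<open>auto simp: bdd_above_def\<close>)
      then show ?thesis using step[OF D(1) uv(1) lt] D by simp
    qed
    then have "Sup (T u) \<le> Sup (T v) - norm (fn \<gamma> v - fn \<gamma> u)" by (rule cSup_least[OF ne])
    then show ?thesis by simp
  qed simp
  then have "dominates (\<lambda>u. Sup (T u)) (fn \<gamma>) {lo \<gamma>..hi \<gamma>}" by (auto simp: dominates_def)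
  then show ?thesis by (rule that)
qed

section \<open>Mean value estimates for Riemann--Stieltjes integrals\<close>

lemma tagged_interval:
  fixes a b :: real
  assumes "D tagged_division_of {a..b}" "(t, K) \<in> D"
  shows "a \<le> Inf K" "Inf K \<le> t" "t \<le> Sup K" "Sup K \<le> b" "Inf K \<in> K" "Sup K \<in> K"
proof -
  obtain u v where K: "K = cbox u v" using assms by blast
  have "t \<in> K" "K \<subseteq> {a..b}" using assms by blast+
  with K have "u \<le> v" "K = {u..v}" by auto
  with \<open>t \<in> K\<close> \<open>K \<subseteq> {a..b}\<close> show "a \<le> Inf K" "Inf K \<le> t" "t \<le> Sup K" "Sup K \<le> b" "Inf K \<in> K" "Sup K \<in> K"
    by auto
qed

text \<open>
  Increments of \<open>\<Phi>\<close> and of \<open>W\<close> both telescope over a tagged division, so errors measured in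
  \<open>W\<close> on the pieces add up to the same error on the whole interval. All estimates below are
  summed in this way.
\<close>
lemma stieltjes_sum_error:
  fixes p \<Phi> \<phi> :: "real \<Rightarrow> complex"
  assumes ab: "a \<le> b" and D: "D tagged_division_of {a..b}"
    and est: "\<And>t K. (t, K) \<in> D \<Longrightarrow>
      norm (\<phi> t * (p (Sup K) - p (Inf K)) - (\<Phi> (Sup K) - \<Phi> (Inf K))) \<le> \<epsilon> * (W (Sup K) - W (Inf K))"
  shows "norm ((\<Sum>(t, K)\<in>D. \<phi> t * (p (Sup K) - p (Inf K))) - (\<Phi> b - \<Phi> a)) \<le> \<epsilon> * (W b - W a)"
proof -
  have "(\<Sum>(t, K)\<in>D. \<phi> t * (p (Sup K) - p (Inf K))) - (\<Phi> b - \<Phi> a)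
      = (\<Sum>(t, K)\<in>D. \<phi> t * (p (Sup K) - p (Inf K)) - (\<Phi> (Sup K) - \<Phi> (Inf K)))"
    by (simp add: additive_tagged_division_1[OF ab D, symmetric] sum_subtractf[symmetric] split_def)
  also have "norm \<dots> \<le> (\<Sum>(t, K)\<in>D. \<epsilon> * (W (Sup K) - W (Inf K)))"
    by (rule sum_norm_le) (use est in auto)
  also have "\<dots> = \<epsilon> * (W b - W a)"
    by (simp add: additive_tagged_division_1[OF ab D, symmetric] sum_distrib_left split_def)
  finally show ?thesis .
qed

text \<open>
  The integral of the constant \<open>c\<close> is \<open>c (\<gamma>\<^sup>+ - \<gamma>\<^sup>-)\<close> in every Riemann--Stieltjes sum, and the
  integral of a function bounded by \<open>\<eta>\<close> is at most \<open>\<eta>\<close> times the variation.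
\<close>
lemma path_integral_mean_value:
  assumes I: "has_path_integral h I \<gamma>" and path: "is_path \<gamma>"
    and W: "dominates W (fn \<gamma>) {lo \<gamma>..hi \<gamma>}"
    and close: "\<And>t. t \<in> {lo \<gamma>..hi \<gamma>} \<Longrightarrow> norm (h (fn \<gamma> t) - c) \<le> \<eta>"
  shows "norm (I - c * (path_end \<gamma> - path_start \<gamma>)) \<le> \<eta> * (W (hi \<gamma>) - W (lo \<gamma>))"
proof (rule field_le_epsilon)
  fix e :: real assume e: "e > 0"
  have lohi: "lo \<gamma> \<le> hi \<gamma>" using path by (simp add: is_path_def)
  obtain \<delta> where \<delta>: "\<delta> > 0" "\<And>D. D tagged_division_of {lo \<gamma>..hi \<gamma>} \<Longrightarrow>
        (\<forall>(t, K)\<in>D. Sup K - Inf K < \<delta>) \<Longrightarrow>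
        norm ((\<Sum>(t, K)\<in>D. h (fn \<gamma> t) * (fn \<gamma> (Sup K) - fn \<gamma> (Inf K))) - I) < e"
    using I e unfolding has_path_integral_def by meson
  have "gauge (\<lambda>t::real. ball t (\<delta>/2))" using \<delta>(1) by (intro gauge_ball) auto
  then obtain D where D: "D tagged_division_of {lo \<gamma>..hi \<gamma>}" "(\<lambda>t. ball t (\<delta>/2)) fine D"
    using fine_division_exists_real by blast
  have "Sup K - Inf K < \<delta>" if tK: "(t, K) \<in> D" for t K
  proof -
    note i = tagged_interval[OF D(1) tK]
    have "K \<subseteq> ball t (\<delta>/2)" using D(2) tK by blast
    then have "Inf K \<in> ball t (\<delta>/2)" "Sup K \<in> ball t (\<delta>/2)" using i by blast+
    then show ?thesis unfolding mem_ball dist_real_def by linarith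
  qed
  then have 1: "norm ((\<Sum>(t, K)\<in>D. h (fn \<gamma> t) * (fn \<gamma> (Sup K) - fn \<gamma> (Inf K))) - I) < e"
    (is "norm (?S - I) < e") using \<delta>(2)[OF D(1)] by blast
  have 2: "norm (?S - (c * fn \<gamma> (hi \<gamma>) - c * fn \<gamma> (lo \<gamma>))) \<le> \<eta> * (W (hi \<gamma>) - W (lo \<gamma>))"
  proof (rule stieltjes_sum_error[OF lohi D(1)])
    fix t K assume tK: "(t, K) \<in> D"
    note i = tagged_interval[OF D(1) tK]
    have "norm (h (fn \<gamma> t) * (fn \<gamma> (Sup K) - fn \<gamma> (Inf K)) - (c * fn \<gamma> (Sup K) - c * fn \<gamma> (Inf K)))
        = norm (h (fn \<gamma> t) - c) * norm (fn \<gamma> (Sup K) - fn \<gamma> (Inf K))"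
      by (simp add: norm_mult[symmetric] algebra_simps)
    also have "\<dots> \<le> \<eta> * (W (Sup K) - W (Inf K))"
    proof (rule mult_mono')
      show "norm (h (fn \<gamma> t) - c) \<le> \<eta>" using close i by auto
      show "norm (fn \<gamma> (Sup K) - fn \<gamma> (Inf K)) \<le> W (Sup K) - W (Inf K)"
        using i by (intro dominatesD[OF W]) auto
    qed auto
    finally show "norm (h (fn \<gamma> t) * (fn \<gamma> (Sup K) - fn \<gamma> (Inf K))
        - (c * fn \<gamma> (Sup K) - c * fn \<gamma> (Inf K))) \<le> \<eta> * (W (Sup K) - W (Inf K))" .
  qed
  have "I - c * (path_end \<gamma> - path_start \<gamma>)
      = (?S - (c * fn \<gamma> (hi \<gamma>) - c * fn \<gamma> (lo \<gamma>))) - (?S - I)"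
    by (simp add: path_end_def path_start_def algebra_simps)
  also have "norm \<dots> \<le> \<eta> * (W (hi \<gamma>) - W (lo \<gamma>)) + e"
    using norm_triangle_ineq4[of "?S - (c * fn \<gamma> (hi \<gamma>) - c * fn \<gamma> (lo \<gamma>))" "?S - I"] 1 2 by linarith
  finally show "norm (I - c * (path_end \<gamma> - path_start \<gamma>)) \<le> \<eta> * (W (hi \<gamma>) - W (lo \<gamma>)) + e" .
qed

text \<open>
  A substitute for ``\<open>\<Phi>(v) - \<Phi>(u)\<close> is the integral of \<open>\<phi> dp\<close> over \<open>[u,v]\<close>'' that mentions no
  sums: it behaves well under limits and can be checked locally.
\<close>
definition mean_value_primitive ::
    "(real \<Rightarrow> real) \<Rightarrow> (real \<Rightarrow> complex) \<Rightarrow> real \<Rightarrow> real \<Rightarrow> (real \<Rightarrow> complex) \<Rightarrow> (real \<Rightarrow> complex) \<Rightarrow> bool"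
  where "mean_value_primitive W p a b \<phi> \<Phi> \<longleftrightarrow>
    (\<forall>u v c \<eta>. a \<le> u \<longrightarrow> u \<le> v \<longrightarrow> v \<le> b \<longrightarrow> (\<forall>t\<in>{u..v}. norm (\<phi> t - c) \<le> \<eta>) \<longrightarrow>
       norm (\<Phi> v - \<Phi> u - c * (p v - p u)) \<le> \<eta> * (W v - W u))"

lemma mean_value_primitiveD:
  assumes "mean_value_primitive W p a b \<phi> \<Phi>" "a \<le> u" "u \<le> v" "v \<le> b"
    "\<And>t. u \<le> t \<Longrightarrow> t \<le> v \<Longrightarrow> norm (\<phi> t - c) \<le> \<eta>"
  shows "norm (\<Phi> v - \<Phi> u - c * (p v - p u)) \<le> \<eta> * (W v - W u)"
  using assms unfolding mean_value_primitive_def by auto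

text \<open>
  For fixed \<open>e\<close>, each point has a neighbourhood in which the error is at most \<open>e (W(v) - W(u))\<close>.
  By Cousin's lemma some tagged division of \<open>[x,y]\<close> is subordinate to these neighbourhoods;
  summing over it bounds the total error by \<open>e (W(y) - W(x))\<close>, and \<open>e\<close> is arbitrary.
\<close>
lemma mean_value_primitive_localI:
  assumes W: "dominates W p {a..b}"
    and loc: "\<And>t e. a \<le> t \<Longrightarrow> t \<le> b \<Longrightarrow> e > 0 \<Longrightarrow> \<exists>\<delta>>0. \<forall>u v. a \<le> u \<longrightarrow> u \<le> t \<longrightarrow> t \<le> v \<longrightarrow>
      v \<le> b \<longrightarrow> v - u < \<delta> \<longrightarrow> norm (\<phi> t * (p v - p u) - (\<Phi> v - \<Phi> u)) \<le> e * (W v - W u)"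
  shows "mean_value_primitive W p a b \<phi> \<Phi>"
  unfolding mean_value_primitive_def
proof (intro allI impI)
  fix x y c \<eta>
  assume xy: "a \<le> x" "x \<le> y" "y \<le> b" and close: "\<forall>t\<in>{x..y}. norm (\<phi> t - c) \<le> \<eta>"
  have Wxy: "0 \<le> W y - W x" using dominates_incr[OF W xy] .
  have est: "norm (\<Phi> y - \<Phi> x - c * (p y - p x)) \<le> (\<eta> + e) * (W y - W x)" if e: "e > 0" for e
  proof -
    have "\<forall>t. \<exists>\<delta>>0. a \<le> t \<longrightarrow> t \<le> b \<longrightarrow> (\<forall>u v. a \<le> u \<longrightarrow> u \<le> t \<longrightarrow> t \<le> v \<longrightarrow> v \<le> b \<longrightarrow> v - u < \<delta> \<longrightarrow>
        norm (\<phi> t * (p v - p u) - (\<Phi> v - \<Phi> u)) \<le> e * (W v - W u))"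
    proof
      fix t
      show "\<exists>\<delta>>0. a \<le> t \<longrightarrow> t \<le> b \<longrightarrow> (\<forall>u v. a \<le> u \<longrightarrow> u \<le> t \<longrightarrow> t \<le> v \<longrightarrow> v \<le> b \<longrightarrow> v - u < \<delta> \<longrightarrow>
        norm (\<phi> t * (p v - p u) - (\<Phi> v - \<Phi> u)) \<le> e * (W v - W u))"
        using loc[OF _ _ e, of t] by (cases "a \<le> t \<and> t \<le> b") (auto intro: exI[of _ 1])
    qed
    from choice[OF this] obtain \<delta> where \<delta>0: "\<And>t. \<delta> t > 0"
      and \<delta>: "\<And>t u v. a \<le> u \<Longrightarrow> u \<le> t \<Longrightarrow> t \<le> v \<Longrightarrow> v \<le> b \<Longrightarrow> v - u < \<delta> t \<Longrightarrow>
        norm (\<phi> t * (p v - p u) - (\<Phi> v - \<Phi> u)) \<le> e * (W v - W u)"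
      by (meson order_trans)
    have "gauge (\<lambda>t. ball t (\<delta> t / 2))" using \<delta>0 by (intro gauge_ball_dependent) auto
    then obtain D where D: "D tagged_division_of {x..y}" "(\<lambda>t. ball t (\<delta> t / 2)) fine D"
      using fine_division_exists_real by blast
    have "norm ((\<Sum>(t, K)\<in>D. c * (p (Sup K) - p (Inf K))) - (\<Phi> y - \<Phi> x)) \<le> (\<eta> + e) * (W y - W x)"
    proof (rule stieltjes_sum_error[OF xy(2) D(1)])
      fix t K assume tK: "(t, K) \<in> D"
      note i = tagged_interval[OF D(1) tK]
      have "K \<subseteq> ball t (\<delta> t / 2)" using D(2) tK by blast
      then have "Inf K \<in> ball t (\<delta> t / 2)" "Sup K \<in> ball t (\<delta> t / 2)" using i by blast+
      then have "Sup K - Inf K < \<delta> t" unfolding mem_ball dist_real_def by linarith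
      then have 1: "norm (\<phi> t * (p (Sup K) - p (Inf K)) - (\<Phi> (Sup K) - \<Phi> (Inf K)))
          \<le> e * (W (Sup K) - W (Inf K))"
        using i xy by (intro \<delta>) auto
      have "norm ((\<phi> t - c) * (p (Sup K) - p (Inf K))) \<le> \<eta> * (W (Sup K) - W (Inf K))"
        unfolding norm_mult
      proof (rule mult_mono')
        show "norm (\<phi> t - c) \<le> \<eta>" using close i by auto
        show "norm (p (Sup K) - p (Inf K)) \<le> W (Sup K) - W (Inf K)"
          using i xy by (intro dominatesD[OF W]) auto
      qed auto
      then have "norm ((\<phi> t * (p (Sup K) - p (Inf K)) - (\<Phi> (Sup K) - \<Phi> (Inf K)))
          - (\<phi> t - c) * (p (Sup K) - p (Inf K))) \<le> e * (W (Sup K) - W (Inf K)) + \<eta> * (W (Sup K) - W (Inf K))"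
        by (rule order_trans[OF norm_triangle_ineq4 add_mono[OF 1]])
      then show "norm (c * (p (Sup K) - p (Inf K)) - (\<Phi> (Sup K) - \<Phi> (Inf K)))
          \<le> (\<eta> + e) * (W (Sup K) - W (Inf K))"
        by (simp add: algebra_simps)
    qed
    moreover have "(\<Sum>(t, K)\<in>D. c * (p (Sup K) - p (Inf K))) = c * (p y - p x)"
      by (simp add: additive_tagged_division_1[OF xy(2) D(1), symmetric] sum_distrib_left split_def)
    ultimately show ?thesis by (metis norm_minus_commute)
  qed
  show "norm (\<Phi> y - \<Phi> x - c * (p y - p x)) \<le> \<eta> * (W y - W x)"
  proof (rule field_le_epsilon)
    fix r :: real assume r: "r > 0"
    define e where "e = r / (W y - W x + 1)"
    have "e > 0" using r Wxy by (simp add: e_def)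
    moreover have "e * (W y - W x) \<le> r" using r Wxy by (simp add: e_def field_simps)
    ultimately show "norm (\<Phi> y - \<Phi> x - c * (p y - p x)) \<le> \<eta> * (W y - W x) + r"
      using est[of e] by (simp add: distrib_right)
  qed
qed

text \<open>
  On a piece on which \<open>h \<circ> \<gamma>\<close> oscillates by less than \<open>e\<close>, the mean value estimate with
  \<open>c\<close> the value at the tag compares the term of the Riemann--Stieltjes sum with the increment
  of \<open>\<Phi>\<close>. A small mesh makes this hold on all pieces at once, whatever the tags are.
\<close>
lemma mean_value_primitive_imp_path_integral:
  assumes path: "is_path \<gamma>" and W: "dominates W (fn \<gamma>) {lo \<gamma>..hi \<gamma>}"
    and cont: "continuous_on {lo \<gamma>..hi \<gamma>} (\<lambda>t. h (fn \<gamma> t))"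
    and prim: "mean_value_primitive W (fn \<gamma>) (lo \<gamma>) (hi \<gamma>) (\<lambda>t. h (fn \<gamma> t)) \<Phi>"
  shows "has_path_integral h (\<Phi> (hi \<gamma>) - \<Phi> (lo \<gamma>)) \<gamma>"
  unfolding has_path_integral_def
proof (intro allI impI)
  fix r :: real assume r: "r > 0"
  have lohi: "lo \<gamma> \<le> hi \<gamma>" using path by (simp add: is_path_def)
  have L: "0 \<le> W (hi \<gamma>) - W (lo \<gamma>)" using dominates_incr[OF W _ lohi] by simp
  define e where "e = r / (W (hi \<gamma>) - W (lo \<gamma>) + 1)"
  have e: "e > 0" using r L by (simp add: e_def)
  have eL: "e * (W (hi \<gamma>) - W (lo \<gamma>)) < r" using r L by (simp add: e_def field_simps)
  have "uniformly_continuous_on {lo \<gamma>..hi \<gamma>} (\<lambda>t. h (fn \<gamma> t))"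
    by (rule compact_uniformly_continuous[OF cont]) simp
  then obtain \<delta> where \<delta>0: "\<delta> > 0" and \<delta>: "\<And>s t. s \<in> {lo \<gamma>..hi \<gamma>} \<Longrightarrow> t \<in> {lo \<gamma>..hi \<gamma>} \<Longrightarrow> dist s t < \<delta> \<Longrightarrow>
      dist (h (fn \<gamma> s)) (h (fn \<gamma> t)) < e"
    using e unfolding uniformly_continuous_on_def by meson
  show "\<exists>\<delta>>0. \<forall>D. D tagged_division_of {lo \<gamma>..hi \<gamma>} \<longrightarrow> (\<forall>(t, K)\<in>D. Sup K - Inf K < \<delta>) \<longrightarrow>
        norm ((\<Sum>(t, K)\<in>D. h (fn \<gamma> t) * (fn \<gamma> (Sup K) - fn \<gamma> (Inf K))) - (\<Phi> (hi \<gamma>) - \<Phi> (lo \<gamma>))) < r"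
  proof (intro exI[of _ \<delta>] conjI allI impI \<delta>0)
    fix D assume D: "D tagged_division_of {lo \<gamma>..hi \<gamma>}" and mesh: "\<forall>(t, K)\<in>D. Sup K - Inf K < \<delta>"
    have "norm ((\<Sum>(t, K)\<in>D. h (fn \<gamma> t) * (fn \<gamma> (Sup K) - fn \<gamma> (Inf K))) - (\<Phi> (hi \<gamma>) - \<Phi> (lo \<gamma>)))
        \<le> e * (W (hi \<gamma>) - W (lo \<gamma>))"
    proof (rule stieltjes_sum_error[OF lohi D])
      fix t K assume tK: "(t, K) \<in> D"
      note i = tagged_interval[OF D tK]
      have m: "Sup K - Inf K < \<delta>" using mesh tK by blast
      have "norm (\<Phi> (Sup K) - \<Phi> (Inf K) - h (fn \<gamma> t) * (fn \<gamma> (Sup K) - fn \<gamma> (Inf K)))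
          \<le> e * (W (Sup K) - W (Inf K))"
      proof (rule mean_value_primitiveD[OF prim])
        fix s assume s: "Inf K \<le> s" "s \<le> Sup K"
        have "dist (h (fn \<gamma> s)) (h (fn \<gamma> t)) < e"
          by (rule \<delta>) (use s i m in \<open>auto simp: dist_real_def\<close>)
        then show "norm (h (fn \<gamma> s) - h (fn \<gamma> t)) \<le> e" by (simp add: dist_norm)
      qed (use i in auto)
      then show "norm (h (fn \<gamma> t) * (fn \<gamma> (Sup K) - fn \<gamma> (Inf K)) - (\<Phi> (Sup K) - \<Phi> (Inf K)))
          \<le> e * (W (Sup K) - W (Inf K))"
        by (simp add: norm_minus_commute)
    qed
    with eL show "norm ((\<Sum>(t, K)\<in>D. h (fn \<gamma> t) * (fn \<gamma> (Sup K) - fn \<gamma> (Inf K)))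
        - (\<Phi> (hi \<gamma>) - \<Phi> (lo \<gamma>))) < r" by linarith
  qed
qed

section \<open>Derivatives along a family of paths\<close>

lemma effectiveD:
  assumes "effective X F" "\<gamma> \<in> F"
  shows "is_path \<gamma>" "rectifiable \<gamma>" "\<And>t. lo \<gamma> \<le> t \<Longrightarrow> t \<le> hi \<gamma> \<Longrightarrow> fn \<gamma> t \<in> X"
    "lo \<gamma> < hi \<gamma>" "continuous_on {lo \<gamma>..hi \<gamma>} (fn \<gamma>)" "fn \<gamma> ` {lo \<gamma>..hi \<gamma>} \<subseteq> X"
proof -
  have "is_path \<gamma>" "rectifiable \<gamma>" "path_im \<gamma> \<subseteq> X"
    using assms unfolding effective_def path_in_def admissible_def by blast+
  then show "is_path \<gamma>" "rectifiable \<gamma>" "\<And>t. lo \<gamma> \<le> t \<Longrightarrow> t \<le> hi \<gamma> \<Longrightarrow> fn \<gamma> t \<in> X"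
    "lo \<gamma> < hi \<gamma>" "continuous_on {lo \<gamma>..hi \<gamma>} (fn \<gamma>)" "fn \<gamma> ` {lo \<gamma>..hi \<gamma>} \<subseteq> X"
    by (auto simp: path_im_def is_path_def)
qed

text \<open>
  Closure of \<open>F\<close> under subpaths turns the integral identity into information on every
  parameter interval.
\<close>
lemma F_derivative_mean_value_primitive:
  assumes eff: "effective X F" and der: "is_F_derivative X F f h" and \<gamma>: "\<gamma> \<in> F"
    and W: "dominates W (fn \<gamma>) {lo \<gamma>..hi \<gamma>}"
  shows "mean_value_primitive W (fn \<gamma>) (lo \<gamma>) (hi \<gamma>) (\<lambda>t. h (fn \<gamma> t)) (\<lambda>t. f (fn \<gamma> t))"
  unfolding mean_value_primitive_def
proof (intro allI impI)
  fix u v c \<eta>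
  assume uv: "lo \<gamma> \<le> u" "u \<le> v" "v \<le> hi \<gamma>" and close: "\<forall>t\<in>{u..v}. norm (h (fn \<gamma> t) - c) \<le> \<eta>"
  show "norm (f (fn \<gamma> v) - f (fn \<gamma> u) - c * (fn \<gamma> v - fn \<gamma> u)) \<le> \<eta> * (W v - W u)"
  proof (cases "u = v")
    case False
    define \<sigma> where "\<sigma> = Plane_Path u v (restrict (fn \<gamma>) {u..v})"
    have "subpath_of \<sigma> \<gamma>" using uv False unfolding subpath_of_def \<sigma>_def by auto
    then have \<sigma>: "\<sigma> \<in> F" using eff \<gamma> unfolding effective_def by blast
    have "has_path_integral h (f (path_end \<sigma>) - f (path_start \<sigma>)) \<sigma>"
      using der \<sigma> by (auto simp: is_F_derivative_def)
    then have "norm (f (path_end \<sigma>) - f (path_start \<sigma>) - c * (path_end \<sigma> - path_start \<sigma>))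
        \<le> \<eta> * (W (hi \<sigma>) - W (lo \<sigma>))"
      by (rule path_integral_mean_value[OF _ effectiveD(1)[OF eff \<sigma>]])
         (use W close uv in \<open>auto simp: \<sigma>_def dominates_def\<close>)
    then show ?thesis using uv by (simp add: \<sigma>_def path_end_def path_start_def)
  qed simp
qed

lemma is_F_derivativeI:
  assumes eff: "effective X F" and "continuous_on X f" and h: "continuous_on X h"
    and prim: "\<And>\<gamma> W. \<gamma> \<in> F \<Longrightarrow> dominates W (fn \<gamma>) {lo \<gamma>..hi \<gamma>} \<Longrightarrow>
      mean_value_primitive W (fn \<gamma>) (lo \<gamma>) (hi \<gamma>) (\<lambda>t. h (fn \<gamma> t)) (\<lambda>t. f (fn \<gamma> t))"
  shows "is_F_derivative X F f h"
  unfolding is_F_derivative_def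
proof (intro conjI ballI)
  fix \<gamma> assume \<gamma>: "\<gamma> \<in> F"
  note e = effectiveD[OF eff \<gamma>]
  obtain W where W: "dominates W (fn \<gamma>) {lo \<gamma>..hi \<gamma>}" using rectifiable_dominated[OF e(2)] .
  show "has_path_integral h (f (path_end \<gamma>) - f (path_start \<gamma>)) \<gamma>"
    unfolding path_end_def path_start_def
    by (rule mean_value_primitive_imp_path_integral[OF e(1) W _ prim[OF \<gamma> W]])
       (rule continuous_on_compose2[OF h e(5,6)])
qed (use assms in auto)

text \<open>
  Replacing \<open>h\<close> by a function within \<open>d\<close> of it raises \<open>\<eta>\<close> by at most \<open>d\<close>, and replacing \<open>f\<close>
  changes an increment by at most \<open>2 d\<close>; so the mean value estimates pass to the limit.
\<close>
lemma is_F_derivative_uniform_limit: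
  assumes eff: "effective X F" and f: "continuous_on X f" and h: "continuous_on X h"
    and approx: "\<And>e. e > 0 \<Longrightarrow> \<exists>f' h'. is_F_derivative X F f' h' \<and>
      (\<forall>z\<in>X. norm (f z - f' z) \<le> e) \<and> (\<forall>z\<in>X. norm (h z - h' z) \<le> e)"
  shows "is_F_derivative X F f h"
proof (rule is_F_derivativeI[OF eff f h])
  fix \<gamma> W assume \<gamma>: "\<gamma> \<in> F" and W: "dominates W (fn \<gamma>) {lo \<gamma>..hi \<gamma>}"
  note e = effectiveD[OF eff \<gamma>]
  show "mean_value_primitive W (fn \<gamma>) (lo \<gamma>) (hi \<gamma>) (\<lambda>t. h (fn \<gamma> t)) (\<lambda>t. f (fn \<gamma> t))"
    unfolding mean_value_primitive_def
  proof (intro allI impI)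
    fix u v c \<eta>
    assume uv: "lo \<gamma> \<le> u" "u \<le> v" "v \<le> hi \<gamma>" and close: "\<forall>t\<in>{u..v}. norm (h (fn \<gamma> t) - c) \<le> \<eta>"
    have Wuv: "0 \<le> W v - W u" using dominates_incr[OF W uv] .
    show "norm (f (fn \<gamma> v) - f (fn \<gamma> u) - c * (fn \<gamma> v - fn \<gamma> u)) \<le> \<eta> * (W v - W u)"
    proof (rule field_le_epsilon)
      fix r :: real assume r: "r > 0"
      \<comment> \<open>chosen so that the errors \<open>d (W v - W u)\<close> from \<open>h\<close> and \<open>2 d\<close> from \<open>f\<close> sum to \<open>r\<close>\<close>
      define d where "d = r / (W v - W u + 2)"
      have d: "d > 0" using r Wuv by (simp add: d_def)
      have dr: "d * (W v - W u) + 2 * d = r"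
      proof -
        have "d * (W v - W u + 2) = r" using Wuv by (simp add: d_def)
        then show ?thesis by (simp add: algebra_simps)
      qed
      obtain f' h' where der: "is_F_derivative X F f' h'"
        and f': "\<And>z. z \<in> X \<Longrightarrow> norm (f z - f' z) \<le> d" and h': "\<And>z. z \<in> X \<Longrightarrow> norm (h z - h' z) \<le> d"
        using approx[OF d] by blast
      have "norm (f' (fn \<gamma> v) - f' (fn \<gamma> u) - c * (fn \<gamma> v - fn \<gamma> u)) \<le> (\<eta> + d) * (W v - W u)"
      proof (rule mean_value_primitiveD[OF F_derivative_mean_value_primitive[OF eff der \<gamma> W] uv])
        fix t assume t: "u \<le> t" "t \<le> v"
        have "norm (h (fn \<gamma> t) - h' (fn \<gamma> t)) \<le> d" using h' e(3) uv t by auto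
        moreover have "norm (h (fn \<gamma> t) - c) \<le> \<eta>" using close t by auto
        moreover have "h' (fn \<gamma> t) - c = (h (fn \<gamma> t) - c) - (h (fn \<gamma> t) - h' (fn \<gamma> t))" by simp
        ultimately show "norm (h' (fn \<gamma> t) - c) \<le> \<eta> + d"
          by (metis add_mono norm_triangle_ineq4 order_trans)
      qed
      moreover have "norm (f (fn \<gamma> v) - f' (fn \<gamma> v)) \<le> d" "norm (f (fn \<gamma> u) - f' (fn \<gamma> u)) \<le> d"
        using f' e(3) uv by auto
      moreover have "f (fn \<gamma> v) - f (fn \<gamma> u) - c * (fn \<gamma> v - fn \<gamma> u)
          = (f' (fn \<gamma> v) - f' (fn \<gamma> u) - c * (fn \<gamma> v - fn \<gamma> u))
            + ((f (fn \<gamma> v) - f' (fn \<gamma> v)) - (f (fn \<gamma> u) - f' (fn \<gamma> u)))"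
        by simp
      moreover have "norm (x + (y - z)) \<le> norm x + (norm y + norm z)" for x y z :: complex
        by (meson add_left_mono norm_triangle_ineq norm_triangle_ineq4 order_trans)
      ultimately have "norm (f (fn \<gamma> v) - f (fn \<gamma> u) - c * (fn \<gamma> v - fn \<gamma> u))
          \<le> (\<eta> + d) * (W v - W u) + (d + d)"
        by (smt (verit))
      also have "\<dots> = \<eta> * (W v - W u) + r" using dr by (simp add: distrib_right)
      finally show "norm (f (fn \<gamma> v) - f (fn \<gamma> u) - c * (fn \<gamma> v - fn \<gamma> u)) \<le> \<eta> * (W v - W u) + r" .
    qed
  qed
qed

section \<open>The chain rule for a complex-differentiable outer function\<close>

text \<open>
  Write \<open>p\<close> for the path and \<open>q\<close> for \<open>g \<circ> p\<close>. Near a parameter \<open>t\<close>, the increment of \<open>f \<circ> q\<close> is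
  \<open>f'(q(t))\<close> times that of \<open>q\<close>, up to \<open>o(|q(s) - q(t)|)\<close>, and the increment of \<open>q\<close> is \<open>h(p(t))\<close>
  times that of \<open>p\<close>, up to \<open>o(W(v) - W(u))\<close>. Since the increments of \<open>q\<close> are at most \<open>sup |h|\<close> times
  those of \<open>W\<close>, both errors are of the second kind. The limit along \<open>X\<close> suffices for the first
  expansion because \<open>q\<close> takes its values in \<open>X\<close>.
\<close>
lemma F_derivative_chain_rule_D1:
  assumes eff: "effective X F" and X: "compact X"
    and f: "\<And>z. z \<in> X \<Longrightarrow> (f has_field_derivative f' z) (at z within X)" and f': "continuous_on X f'"
    and g: "is_F_derivative X F g h" and gX: "g ` X \<subseteq> X"
  shows "is_F_derivative X F (f \<circ> g) (\<lambda>z. f' (g z) * h z)"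
proof (rule is_F_derivativeI[OF eff])
  have gc: "continuous_on X g" and hc: "continuous_on X h" using g by (auto simp: is_F_derivative_def)
  have fc: "continuous_on X f" using f by (rule DERIV_continuous_on)
  show "continuous_on X (f \<circ> g)" using gc continuous_on_subset[OF fc gX] by (rule continuous_on_compose)
  show "continuous_on X (\<lambda>z. f' (g z) * h z)"
    by (intro continuous_on_mult hc continuous_on_compose2[OF f' gc gX])
  fix \<gamma> W assume \<gamma>: "\<gamma> \<in> F" and W: "dominates W (fn \<gamma>) {lo \<gamma>..hi \<gamma>}"
  note e = effectiveD[OF eff \<gamma>]
  define p where "p = fn \<gamma>"
  define q where "q t = g (p t)" for t
  have prim: "mean_value_primitive W p (lo \<gamma>) (hi \<gamma>) (\<lambda>t. h (p t)) q"
    using F_derivative_mean_value_primitive[OF eff g \<gamma> W] unfolding p_def q_def .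
  have pX: "p t \<in> X" if "lo \<gamma> \<le> t" "t \<le> hi \<gamma>" for t using e(3) that by (simp add: p_def)
  have qX: "q t \<in> X" if "lo \<gamma> \<le> t" "t \<le> hi \<gamma>" for t using pX[OF that] gX by (auto simp: q_def)
  have "compact (h ` X)" by (rule compact_continuous_image[OF hc X])
  then obtain M where M: "\<And>z. z \<in> X \<Longrightarrow> norm (h z) \<le> M"
    using compact_imp_bounded bounded_iff by (metis imageI)
  have M0: "0 \<le> M" using M[OF pX[of "lo \<gamma>"]] e(4) norm_ge_zero by (meson less_imp_le order_trans order_refl)
  have qW: "norm (q v - q u) \<le> M * (W v - W u)" if "lo \<gamma> \<le> u" "u \<le> v" "v \<le> hi \<gamma>" for u v
    using mean_value_primitiveD[OF prim that, of 0 M] M pX that by fastforce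
  have pc: "continuous_on {lo \<gamma>..hi \<gamma>} p" using e(5) by (simp add: p_def)
  have pim: "p ` {lo \<gamma>..hi \<gamma>} \<subseteq> X" using e(6) by (simp add: p_def)
  have qc: "continuous_on {lo \<gamma>..hi \<gamma>} q" unfolding q_def by (rule continuous_on_compose2[OF gc pc pim])
  have hpc: "continuous_on {lo \<gamma>..hi \<gamma>} (\<lambda>t. h (p t))" by (rule continuous_on_compose2[OF hc pc pim])
  have "mean_value_primitive W p (lo \<gamma>) (hi \<gamma>) (\<lambda>t. f' (q t) * h (p t)) (\<lambda>t. f (q t))"
  proof (rule mean_value_primitive_localI)
    show "dominates W p {lo \<gamma>..hi \<gamma>}" using W by (simp add: p_def)
    fix t r :: real assume t: "lo \<gamma> \<le> t" "t \<le> hi \<gamma>" and r: "r > 0"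
    \<comment> \<open>The remainder of \<open>f\<close> costs \<open>d M\<close> and that of \<open>q\<close> costs \<open>d |f'(q t)|\<close>, per unit of \<open>W\<close>;
      the summand 1 keeps the denominator positive.\<close>
    define d where "d = r / (M + norm (f' (q t)) + 1)"
    have pos: "M + norm (f' (q t)) + 1 > 0" using M0 by (simp add: add_nonneg_pos)
    have d: "d > 0" using r pos by (simp add: d_def)
    have dr: "d * M + norm (f' (q t)) * d \<le> r"
    proof -
      have "d * (M + norm (f' (q t)) + 1) = r" using pos by (simp add: d_def)
      then show ?thesis using d by (simp add: algebra_simps)
    qed
    obtain \<delta>1 where \<delta>1: "\<delta>1 > 0" "\<And>y. y \<in> X \<Longrightarrow> norm (y - q t) < \<delta>1 \<Longrightarrow>
        norm (f y - f (q t) - f' (q t) * (y - q t)) \<le> d * norm (y - q t)"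
      using f[OF qX[OF t]] d unfolding has_field_derivative_def has_derivative_within_alt by blast
    obtain \<delta>2 where \<delta>2: "\<delta>2 > 0" "\<And>s. s \<in> {lo \<gamma>..hi \<gamma>} \<Longrightarrow> dist s t < \<delta>2 \<Longrightarrow> dist (q s) (q t) < \<delta>1"
      using qc \<delta>1(1) t unfolding continuous_on_iff by (meson atLeastAtMost_iff)
    obtain \<delta>3 where \<delta>3: "\<delta>3 > 0" "\<And>s. s \<in> {lo \<gamma>..hi \<gamma>} \<Longrightarrow> dist s t < \<delta>3 \<Longrightarrow> dist (h (p s)) (h (p t)) < d"
      using hpc d t unfolding continuous_on_iff by (meson atLeastAtMost_iff)
    show "\<exists>\<delta>>0. \<forall>u v. lo \<gamma> \<le> u \<longrightarrow> u \<le> t \<longrightarrow> t \<le> v \<longrightarrow> v \<le> hi \<gamma> \<longrightarrow> v - u < \<delta> \<longrightarrow>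
      norm (f' (q t) * h (p t) * (p v - p u) - (f (q v) - f (q u))) \<le> r * (W v - W u)"
    proof (intro exI[of _ "min \<delta>2 \<delta>3"] conjI allI impI)
      show "min \<delta>2 \<delta>3 > 0" using \<delta>2 \<delta>3 by simp
      fix u v assume uv: "lo \<gamma> \<le> u" "u \<le> t" "t \<le> v" "v \<le> hi \<gamma>" "v - u < min \<delta>2 \<delta>3"
      define R where "R s = f (q s) - f (q t) - f' (q t) * (q s - q t)" for s
      have R: "norm (R s) \<le> d * norm (q s - q t)" if "u \<le> s" "s \<le> v" for s
      proof -
        have "dist (q s) (q t) < \<delta>1"
          by (rule \<delta>2(2)) (use that uv in \<open>auto simp: dist_real_def\<close>)
        then show ?thesis using \<delta>1(2)[of "q s"] qX[of s] that uv by (auto simp: R_def dist_norm)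
      qed
      \<comment> \<open>The derivative is taken at \<open>t\<close>, so the increment of \<open>f \<circ> q\<close> over \<open>[u,v]\<close> is split at \<open>t\<close>.\<close>
      have Rv: "norm (R v) \<le> d * (M * (W v - W t))"
        using R[of v] qW[of t v] uv d by (meson mult_left_mono order_trans less_imp_le order_refl)
      have "norm (q u - q t) \<le> M * (W t - W u)" using qW[of u t] uv by (simp add: norm_minus_commute)
      then have Ru: "norm (R u) \<le> d * (M * (W t - W u))"
        using R[of u] uv d by (meson mult_left_mono order_trans less_imp_le order_refl)
      have "norm (q v - q u - h (p t) * (p v - p u)) \<le> d * (W v - W u)"
      proof (rule mean_value_primitiveD[OF prim])
        fix s assume s: "u \<le> s" "s \<le> v"
        have "dist (h (p s)) (h (p t)) < d"
          by (rule \<delta>3(2)) (use s uv in \<open>auto simp: dist_real_def\<close>)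
        then show "norm (h (p s) - h (p t)) \<le> d" by (simp add: dist_norm)
      qed (use uv in auto)
      then have Q: "norm (f' (q t) * (q v - q u - h (p t) * (p v - p u))) \<le> norm (f' (q t)) * (d * (W v - W u))"
        unfolding norm_mult by (intro mult_left_mono) auto
      have "f' (q t) * h (p t) * (p v - p u) - (f (q v) - f (q u))
          = (R u - R v) - f' (q t) * (q v - q u - h (p t) * (p v - p u))"
        by (simp add: R_def algebra_simps)
      also have "norm \<dots> \<le> (norm (R u) + norm (R v)) + norm (f' (q t) * (q v - q u - h (p t) * (p v - p u)))"
        by (meson add_right_mono norm_triangle_ineq4 order_trans)
      also have "\<dots> \<le> (d * (M * (W t - W u)) + d * (M * (W v - W t))) + norm (f' (q t)) * (d * (W v - W u))"
        using Ru Rv Q by linarith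
      also have "\<dots> = (d * M + norm (f' (q t)) * d) * (W v - W u)" by (simp add: algebra_simps)
      also have "\<dots> \<le> r * (W v - W u)"
        using dr dominates_incr[OF W, of u v] uv by (intro mult_right_mono) auto
      finally show "norm (f' (q t) * h (p t) * (p v - p u) - (f (q v) - f (q u))) \<le> r * (W v - W u)" .
    qed
  qed
  then show "mean_value_primitive W (fn \<gamma>) (lo \<gamma>) (hi \<gamma>) (\<lambda>t. f' (g (fn \<gamma> t)) * h (fn \<gamma> t)) (\<lambda>t. (f \<circ> g) (fn \<gamma> t))"
    by (simp add: p_def q_def o_def)
qed

text \<open>
  With the identity as inner function, the chain rule shows that a complex derivative is an
  \<open>F\<close>-derivative.
\<close>
lemma F_derivative_ident:
  assumes "effective X F" shows "is_F_derivative X F (\<lambda>z. z) (\<lambda>z. 1)"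
proof (rule is_F_derivativeI[OF assms])
  fix \<gamma> W assume W: "dominates W (fn \<gamma>) {lo \<gamma>..hi \<gamma>}"
  have "mean_value_primitive W (fn \<gamma>) (lo \<gamma>) (hi \<gamma>) (\<lambda>t. 1) (fn \<gamma>)"
    by (rule mean_value_primitive_localI[OF W]) (auto intro!: exI[of _ 1] mult_nonneg_nonneg dominates_incr[OF W])
  then show "mean_value_primitive W (fn \<gamma>) (lo \<gamma>) (hi \<gamma>) (\<lambda>t. 1) (\<lambda>t. fn \<gamma> t)" by simp
qed auto

section \<open>Uniqueness of the derivative\<close>

lemma path_integral_diff:
  assumes "has_path_integral f I \<gamma>" "has_path_integral g J \<gamma>"
  shows "has_path_integral (\<lambda>z. f z - g z) (I - J) \<gamma>"
  unfolding has_path_integral_def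
proof (intro allI impI)
  fix e :: real assume "e > 0"
  then have e: "e / 2 > 0" by simp
  obtain \<delta> where \<delta>: "\<delta> > 0" "\<And>D. D tagged_division_of {lo \<gamma>..hi \<gamma>} \<Longrightarrow>
        (\<forall>(t, K)\<in>D. Sup K - Inf K < \<delta>) \<Longrightarrow>
        norm ((\<Sum>(t, K)\<in>D. f (fn \<gamma> t) * (fn \<gamma> (Sup K) - fn \<gamma> (Inf K))) - I) < e / 2"
    using assms(1) e unfolding has_path_integral_def by meson
  obtain \<delta>' where \<delta>': "\<delta>' > 0" "\<And>D. D tagged_division_of {lo \<gamma>..hi \<gamma>} \<Longrightarrow>
        (\<forall>(t, K)\<in>D. Sup K - Inf K < \<delta>') \<Longrightarrow>
        norm ((\<Sum>(t, K)\<in>D. g (fn \<gamma> t) * (fn \<gamma> (Sup K) - fn \<gamma> (Inf K))) - J) < e / 2"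
    using assms(2) e unfolding has_path_integral_def by meson
  show "\<exists>\<delta>>0. \<forall>D. D tagged_division_of {lo \<gamma>..hi \<gamma>} \<longrightarrow> (\<forall>(t, K)\<in>D. Sup K - Inf K < \<delta>) \<longrightarrow>
        norm ((\<Sum>(t, K)\<in>D. (f (fn \<gamma> t) - g (fn \<gamma> t)) * (fn \<gamma> (Sup K) - fn \<gamma> (Inf K))) - (I - J)) < e"
  proof (intro exI[of _ "min \<delta> \<delta>'"] conjI allI impI)
    show "min \<delta> \<delta>' > 0" using \<delta> \<delta>' by simp
    fix D assume D: "D tagged_division_of {lo \<gamma>..hi \<gamma>}" "\<forall>(t, K)\<in>D. Sup K - Inf K < min \<delta> \<delta>'"
    let ?S = "\<lambda>f. \<Sum>(t, K)\<in>D. f (fn \<gamma> t) * (fn \<gamma> (Sup K) - fn \<gamma> (Inf K))"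
    have "norm (?S f - I) < e / 2" by (rule \<delta>(2)[OF D(1)]) (use D(2) in auto)
    moreover have "norm (?S g - J) < e / 2" by (rule \<delta>'(2)[OF D(1)]) (use D(2) in auto)
    moreover have "?S (\<lambda>z. f z - g z) - (I - J) = (?S f - I) - (?S g - J)"
      by (simp add: left_diff_distrib sum_subtractf split_def)
    ultimately show "norm (?S (\<lambda>z. f z - g z) - (I - J)) < e"
      using norm_triangle_ineq4[of "?S f - I" "?S g - J"] by (smt (verit) field_sum_of_halves)
  qed
qed

lemma is_F_derivative_diff:
  assumes "is_F_derivative X F f h" "is_F_derivative X F g k"
  shows "is_F_derivative X F (\<lambda>z. f z - g z) (\<lambda>z. h z - k z)"
  unfolding is_F_derivative_def
proof (intro conjI ballI)
  fix \<gamma> assume "\<gamma> \<in> F"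
  then have "has_path_integral (\<lambda>z. h z - k z) ((f (path_end \<gamma>) - f (path_start \<gamma>)) - (g (path_end \<gamma>) - g (path_start \<gamma>))) \<gamma>"
    using assms by (intro path_integral_diff) (auto simp: is_F_derivative_def)
  then show "has_path_integral (\<lambda>z. h z - k z) (f (path_end \<gamma>) - g (path_end \<gamma>) - (f (path_start \<gamma>) - g (path_start \<gamma>))) \<gamma>"
    by (simp add: algebra_simps)
qed (use assms in \<open>auto simp: is_F_derivative_def intro!: continuous_intros\<close>)

text \<open>
  If \<open>W\<close> dominates \<open>\<gamma>\<close>, the mean value estimate for the zero function bounds \<open>|c|\<close> times an
  increment of \<open>\<gamma>\<close> by \<open>|c|/2\<close> times that of \<open>W\<close>. For \<open>c \<noteq> 0\<close> this says that \<open>W/2\<close> dominates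
  \<open>\<gamma>\<close> as well; by iteration \<open>\<gamma>\<close> would be constant.
\<close>
lemma F_derivative_zero_on_path:
  assumes eff: "effective X F" and der: "is_F_derivative X F (\<lambda>z. 0) h" and \<gamma>: "\<gamma> \<in> F"
    and close: "\<And>t. t \<in> {lo \<gamma>..hi \<gamma>} \<Longrightarrow> norm (h (fn \<gamma> t) - c) \<le> norm c / 2"
  shows "c = 0"
proof (rule ccontr)
  assume c: "c \<noteq> 0"
  note e = effectiveD[OF eff \<gamma>]
  have halve: "dominates (\<lambda>s. W s / 2) (fn \<gamma>) {lo \<gamma>..hi \<gamma>}"
    if W: "dominates W (fn \<gamma>) {lo \<gamma>..hi \<gamma>}" for W
    unfolding dominates_def
  proof (intro ballI impI)
    fix u v assume uv: "u \<in> {lo \<gamma>..hi \<gamma>}" "v \<in> {lo \<gamma>..hi \<gamma>}" "u \<le> v"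
    have "norm (0 - 0 - c * (fn \<gamma> v - fn \<gamma> u)) \<le> norm c / 2 * (W v - W u)"
      by (rule mean_value_primitiveD[OF F_derivative_mean_value_primitive[OF eff der \<gamma> W]])
         (use close uv in auto)
    then have "norm c * norm (fn \<gamma> v - fn \<gamma> u) \<le> norm c * ((W v - W u) / 2)" by (simp add: norm_mult)
    then show "norm (fn \<gamma> v - fn \<gamma> u) \<le> W v / 2 - W u / 2"
      using c by (simp add: diff_divide_distrib)
  qed
  obtain W where W: "dominates W (fn \<gamma>) {lo \<gamma>..hi \<gamma>}" using rectifiable_dominated[OF e(2)] .
  have iter: "dominates (\<lambda>s. W s / 2 ^ n) (fn \<gamma>) {lo \<gamma>..hi \<gamma>}" for n
  proof (induction n)
    case (Suc n)
    from halve[OF Suc] show ?case by (simp add: mult.commute)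
  qed (use W in simp)
  have "fn \<gamma> t = fn \<gamma> (lo \<gamma>)" if t: "t \<in> {lo \<gamma>..hi \<gamma>}" for t
  proof -
    have bound: "norm (fn \<gamma> t - fn \<gamma> (lo \<gamma>)) \<le> (W t - W (lo \<gamma>)) * (1 / 2) ^ n" for n
    proof -
      have "norm (fn \<gamma> t - fn \<gamma> (lo \<gamma>)) \<le> W t / 2 ^ n - W (lo \<gamma>) / 2 ^ n"
        using t by (intro dominatesD[OF iter]) auto
      then show ?thesis by (simp add: diff_divide_distrib power_one_over)
    qed
    have "(\<lambda>n. (W t - W (lo \<gamma>)) * (1 / 2) ^ n) \<longlonglongrightarrow> (W t - W (lo \<gamma>)) * 0"
      by (intro tendsto_mult tendsto_const LIMSEQ_realpow_zero) auto
    then have "norm (fn \<gamma> t - fn \<gamma> (lo \<gamma>)) \<le> (W t - W (lo \<gamma>)) * 0"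
      by (rule LIMSEQ_le_const) (use bound in blast)
    then show ?thesis by simp
  qed
  then have "constant_path \<gamma>" unfolding constant_path_def by blast
  moreover have "subpath_of \<gamma> \<gamma>"
    using e(1) unfolding subpath_of_def is_path_def
    by (intro exI[of _ "lo \<gamma>"] exI[of _ "hi \<gamma>"]) (auto simp: extensional_restrict)
  ultimately show False using eff \<gamma> unfolding effective_def admissible_def by blast
qed

text \<open>
  If \<open>h\<close> has a non-zero value \<open>c\<close> at a point of a path in \<open>F\<close>, then by continuity it stays within
  \<open>|c|/2\<close> of \<open>c\<close> on a whole subpath, which was just excluded. So \<open>h\<close> vanishes on the images of
  the paths, and these are dense in \<open>X\<close>.
\<close>
lemma F_derivative_zero:
  assumes eff: "effective X F" and X: "compact X"
    and der: "is_F_derivative X F (\<lambda>z. 0) h" and z: "z \<in> X"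
  shows "h z = 0"
proof -
  have hc: "continuous_on X h" using der by (simp add: is_F_derivative_def)
  have zero: "h (fn \<gamma> t) = 0" if \<gamma>: "\<gamma> \<in> F" and t: "lo \<gamma> \<le> t" "t \<le> hi \<gamma>" for \<gamma> t
  proof (rule ccontr)
    assume nz: "h (fn \<gamma> t) \<noteq> 0"
    define c where "c = h (fn \<gamma> t)"
    have c: "norm c / 2 > 0" using nz by (simp add: c_def)
    note e = effectiveD[OF eff \<gamma>]
    have "continuous_on {lo \<gamma>..hi \<gamma>} (\<lambda>t. h (fn \<gamma> t))" by (rule continuous_on_compose2[OF hc e(5,6)])
    then obtain \<delta> where \<delta>: "\<delta> > 0"
      "\<And>s. s \<in> {lo \<gamma>..hi \<gamma>} \<Longrightarrow> dist s t < \<delta> \<Longrightarrow> dist (h (fn \<gamma> s)) c < norm c / 2"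
      using c t unfolding continuous_on_iff c_def by (meson atLeastAtMost_iff)
    define a where "a = max (lo \<gamma>) (t - \<delta> / 2)"
    define b where "b = min (hi \<gamma>) (t + \<delta> / 2)"
    have ab: "lo \<gamma> \<le> a" "a < b" "b \<le> hi \<gamma>" "a > t - \<delta>" "b < t + \<delta>"
      using \<delta>(1) t e(4) by (auto simp: a_def b_def)
    define \<sigma> where "\<sigma> = Plane_Path a b (restrict (fn \<gamma>) {a..b})"
    have "subpath_of \<sigma> \<gamma>" using ab unfolding subpath_of_def \<sigma>_def by auto
    then have \<sigma>: "\<sigma> \<in> F" using eff \<gamma> unfolding effective_def by blast
    have "c = 0"
    proof (rule F_derivative_zero_on_path[OF eff der \<sigma>])
      fix s assume "s \<in> {lo \<sigma>..hi \<sigma>}"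
      then have s: "a \<le> s" "s \<le> b" by (auto simp: \<sigma>_def)
      then have "dist (h (fn \<gamma> s)) c < norm c / 2" using ab by (intro \<delta>(2)) (auto simp: dist_real_def)
      then show "norm (h (fn \<sigma> s) - c) \<le> norm c / 2" using s by (simp add: \<sigma>_def dist_norm)
    qed
    then show False using nz by (simp add: c_def)
  qed
  define S where "S = (\<Union>\<gamma>\<in>F. path_im \<gamma>)"
  have "S \<subseteq> X" using effectiveD(3)[OF eff] by (auto simp: S_def path_im_def)
  moreover have "X \<subseteq> closure S" using eff by (simp add: effective_def S_def)
  ultimately have cl: "closure S = X" using closure_minimal compact_imp_closed[OF X] by blast
  show ?thesis
    by (rule continuous_constant_on_closure[of S h 0])
       (use hc cl z zero in \<open>auto simp: S_def path_im_def\<close>)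
qed

lemma has_path_integral_cong:
  assumes "\<And>t. t \<in> {lo \<gamma>..hi \<gamma>} \<Longrightarrow> f (fn \<gamma> t) = g (fn \<gamma> t)" and f: "has_path_integral f I \<gamma>"
  shows "has_path_integral g I \<gamma>"
proof -
  have "(\<Sum>(t, K)\<in>D. f (fn \<gamma> t) * (fn \<gamma> (Sup K) - fn \<gamma> (Inf K)))
      = (\<Sum>(t, K)\<in>D. g (fn \<gamma> t) * (fn \<gamma> (Sup K) - fn \<gamma> (Inf K)))"
    if D: "D tagged_division_of {lo \<gamma>..hi \<gamma>}" for D
  proof (rule sum.cong[OF refl], clarify)
    fix t K assume "(t, K) \<in> D"
    then have "t \<in> {lo \<gamma>..hi \<gamma>}" using D by blast
    then show "f (fn \<gamma> t) * (fn \<gamma> (Sup K) - fn \<gamma> (Inf K)) = g (fn \<gamma> t) * (fn \<gamma> (Sup K) - fn \<gamma> (Inf K))"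
      using assms(1) by simp
  qed
  then show ?thesis using f by (simp add: has_path_integral_def cong: imp_cong)
qed

lemma is_F_derivative_restrict:
  assumes eff: "effective X F" and der: "is_F_derivative X F f h"
  shows "is_F_derivative X F f (restrict h X)"
  unfolding is_F_derivative_def
proof (intro conjI ballI)
  show "continuous_on X f" "continuous_on X (restrict h X)"
    using der by (auto simp: is_F_derivative_def cong: continuous_on_cong)
  fix \<gamma> assume \<gamma>: "\<gamma> \<in> F"
  show "has_path_integral (restrict h X) (f (path_end \<gamma>) - f (path_start \<gamma>)) \<gamma>"
    by (rule has_path_integral_cong[of _ h])
       (use effectiveD(3)[OF eff \<gamma>] der \<gamma> in \<open>auto simp: is_F_derivative_def\<close>)
qed

lemma F_deriv_eq:
  assumes eff: "effective X F" and X: "compact X" and der: "is_F_derivative X F f h"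
  shows "F_deriv X F f = restrict h X"
  unfolding F_deriv_def
proof (rule the_equality)
  show "restrict h X \<in> extensional X \<and> is_F_derivative X F f (restrict h X)"
    using is_F_derivative_restrict[OF eff der] by simp
  fix k assume k: "k \<in> extensional X \<and> is_F_derivative X F f k"
  have "is_F_derivative X F (\<lambda>z. f z - f z) (\<lambda>z. k z - h z)" using k der by (intro is_F_derivative_diff) auto
  then have "is_F_derivative X F (\<lambda>z. 0) (\<lambda>z. k z - h z)" by simp
  then have "k z = h z" if "z \<in> X" for z using F_derivative_zero[OF eff X _ that] by force
  then show "k = restrict h X" using k by (auto simp: fun_eq_iff extensional_def)
qed

lemma norm_le_sup_norm:
  assumes X: "compact X" and "continuous_on X f" and "z \<in> X"
  shows "norm (f z) \<le> sup_norm X f"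
  unfolding sup_norm_def
proof (rule cSUP_upper[OF \<open>z \<in> X\<close>])
  have "compact ((\<lambda>z. norm (f z)) ` X)" using assms by (intro compact_continuous_image continuous_intros)
  then show "bdd_above ((\<lambda>z. norm (f z)) ` X)" by (intro bounded_imp_bdd_above compact_imp_bounded)
qed

lemma norm_le_F_norm:
  assumes eff: "effective X F" and X: "compact X" and der: "is_F_derivative X F f h" and z: "z \<in> X"
  shows "norm (f z) \<le> F_norm X F f" and "norm (h z) \<le> F_norm X F f"
proof -
  have hc: "continuous_on X (restrict h X)"
    using is_F_derivative_restrict[OF eff der] by (simp add: is_F_derivative_def)
  have f: "norm (f z) \<le> sup_norm X f"
    using der by (intro norm_le_sup_norm[OF X _ z]) (simp add: is_F_derivative_def)
  have h: "norm (h z) \<le> sup_norm X (F_deriv X F f)"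
    using norm_le_sup_norm[OF X hc z] z by (simp add: F_deriv_eq[OF eff X der])
  show "norm (f z) \<le> F_norm X F f" "norm (h z) \<le> F_norm X F f"
    using f h norm_ge_zero[of "f z"] norm_ge_zero[of "h z"] unfolding F_norm_def by linarith+
qed

section \<open>The chain rule under the density assumption\<close>

lemma F_derivative_chain_rule:
  assumes eff: "effective X F" and X: "compact X" and dense: "D1_dense X F"
    and f: "is_F_derivative X F f f1" and g: "is_F_derivative X F g g1" and gX: "g ` X \<subseteq> X"
  shows "is_F_derivative X F (f \<circ> g) (\<lambda>z. f1 (g z) * g1 z)"
proof (rule is_F_derivative_uniform_limit[OF eff])
  have c: "continuous_on X f" "continuous_on X f1" "continuous_on X g" "continuous_on X g1"
    using f g by (auto simp: is_F_derivative_def)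
  show "continuous_on X (f \<circ> g)" using c(3) continuous_on_subset[OF c(1) gX] by (rule continuous_on_compose)
  show "continuous_on X (\<lambda>z. f1 (g z) * g1 z)"
    by (intro continuous_on_mult c(4) continuous_on_compose2[OF c(2,3) gX])
  fix e :: real assume e: "e > 0"
  have "compact (g1 ` X)" by (rule compact_continuous_image[OF c(4) X])
  then obtain M where M0: "M > 0" and M: "\<And>z. z \<in> X \<Longrightarrow> norm (g1 z) \<le> M"
    using compact_imp_bounded bounded_pos by (metis imageI)
  \<comment> \<open>\<open>d \<le> e\<close> controls \<open>f \<circ> g - k \<circ> g\<close>, and \<open>d M \<le> e\<close> controls the product with \<open>g1\<close>.\<close>
  define d where "d = min e (e / M)"
  have d: "d > 0" "d \<le> e" "d * M \<le> e" using e M0 by (auto simp: d_def min_def field_simps)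
  have "f \<in> DF1 X F" using f by (auto simp: DF1_def)
  then obtain k where k: "k \<in> D1 X" "F_norm X F (\<lambda>z. f z - k z) < d"
    using dense d(1) unfolding D1_dense_def by blast
  obtain k1 where k1: "\<And>z. z \<in> X \<Longrightarrow> (k has_field_derivative k1 z) (at z within X)" "continuous_on X k1"
    using k(1) unfolding D1_def by blast
  have "is_F_derivative X F k k1"
    using F_derivative_chain_rule_D1[OF eff X k1 F_derivative_ident[OF eff]] by (simp add: o_def)
  then have diff: "is_F_derivative X F (\<lambda>z. f z - k z) (\<lambda>z. f1 z - k1 z)" by (rule is_F_derivative_diff[OF f])
  note bound = norm_le_F_norm[OF eff X diff, THEN order_trans, OF _ less_imp_le[OF k(2)]]
  show "\<exists>f' h'. is_F_derivative X F f' h' \<and> (\<forall>z\<in>X. norm ((f \<circ> g) z - f' z) \<le> e) \<and>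
      (\<forall>z\<in>X. norm (f1 (g z) * g1 z - h' z) \<le> e)"
  proof (intro exI conjI ballI)
    show "is_F_derivative X F (k \<circ> g) (\<lambda>z. k1 (g z) * g1 z)"
      by (rule F_derivative_chain_rule_D1[OF eff X k1 g gX])
    fix z assume z: "z \<in> X"
    then have gz: "g z \<in> X" using gX by auto
    show "norm ((f \<circ> g) z - (k \<circ> g) z) \<le> e" using bound(1)[OF gz] d(2) by simp
    have "norm (f1 (g z) * g1 z - k1 (g z) * g1 z) = norm (f1 (g z) - k1 (g z)) * norm (g1 z)"
      by (simp add: norm_mult[symmetric] algebra_simps)
    also have "\<dots> \<le> d * M" using bound(2)[OF gz] M[OF z] by (intro mult_mono') auto
    also note d(3)
    finally show "norm (f1 (g z) * g1 z - k1 (g z) * g1 z) \<le> e" .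
  qed
qed

theorem corollary4p4:
  fixes X :: "complex set" and F :: "plane_path set" and f g :: "complex \<Rightarrow> complex"
  assumes "compact_plane_set X" and "semi_rectifiable X"
    and "effective X F"
    and "f \<in> DF1 X F" and "g \<in> DF1 X F"
    and "g ` X \<subseteq> X"
    and "D1_dense X F"
  shows "f \<circ> g \<in> DF1 X F
    \<and> is_F_derivative X F (f \<circ> g) (\<lambda>z. F_deriv X F f (g z) * F_deriv X F g z)
    \<and> (\<forall>z\<in>X. F_deriv X F (f \<circ> g) z = F_deriv X F f (g z) * F_deriv X F g z)"
proof -
  have X: "compact X" using assms(1) by (simp add: compact_plane_set_def)
  note eff = assms(3)
  have F_deriv: "is_F_derivative X F k (F_deriv X F k)" if "k \<in> DF1 X F" for k
  proof -
    obtain h where h: "is_F_derivative X F k h" using \<open>k \<in> DF1 X F\<close> by (auto simp: DF1_def)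
    show ?thesis using is_F_derivative_restrict[OF eff h] by (simp add: F_deriv_eq[OF eff X h])
  qed
  have der: "is_F_derivative X F (f \<circ> g) (\<lambda>z. F_deriv X F f (g z) * F_deriv X F g z)"
    by (rule F_derivative_chain_rule[OF eff X assms(7) F_deriv[OF assms(4)] F_deriv[OF assms(5)] assms(6)])
  then have "f \<circ> g \<in> DF1 X F" unfolding DF1_def by blast
  moreover have "F_deriv X F (f \<circ> g) z = F_deriv X F f (g z) * F_deriv X F g z" if "z \<in> X" for z
    using that by (simp add: F_deriv_eq[OF eff X der])
  ultimately show ?thesis using der by blast
qed

end
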